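(* Let $\mathcal G$ be a polynomial jump-diffusion operator with coefficients $b(x)=b_0+b_1x$, $\sigma^2(x)=\sigma_0+\sigma_1x+\sigma_2x^2$ and $\int_{\mathbb R}z^m\ell(x,dz)=\sum_{i=0}^m\xi_i^mx^i$ for every $m\ge2$, where all $b_i,\sigma_i,\xi_i^m$ are real constants. For every $n\ge2$, the generator matrix $G_n\in\mathbb R^{(n+1)\times(n+1)}$ satisfying $\mathcal GH_n(x)=G_nH_n(x)$ with $H_n(x)=(1,x,\dots,x^n)^{\top}$ is given by $$G_n=\begin{pmatrix}G_{n-1}&\vec 0_n\\ \vec a_n^{\top}&c_n\end{pmatrix},\qquad G_1=\begin{pmatrix}0&0\\ b_0&b_1\end{pmatrix},$$ where $\vec 0_n$ is the $n$-dimensional zero vector, $\vec a_n=(a_n^n,a_n^{n-1},\dots,a_n^1)^{\top}\in\mathbb R^n$ with $$a_n^1=nb_0+\tfrac12n(n-1)\sigma_1+\sum_{k=2}^n\binom nk\xi_{k-1}^k,\qquad a_n^2=\tfrac12n(n-1)\sigma_0+\sum_{k=2}^n\binom nk\xi_{k-2}^k,$$ $$a_n^i=\sum_{k=i}^n\binom nk\xi_{k-i}^k\quad\text{for }i=3,\dots,n,\qquad c_n=nb_1+\tfrac12n(n-1)\sigma_2+\sum_{k=2}^n\binom nk\xi_k^k.$$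
   Context: The jump-diffusion operator is $$\mathcal G f(x)=b(x)f'(x)+\tfrac12\sigma^2(x)f''(x)+\int_{\mathbb R}\left(f(x+z)-f(x)-f'(x)z\right)\ell(x,dz),$$ with $b,\sigma:\mathbb R\to\mathbb R$ measurable and $\ell$ a transition kernel with $\ell(x,\{0\})=0$, $\int_{\mathbb R}|z|\wedge|z|^2\ell(x,dz)<\infty$ and $\int_{\mathbb R}|z|^n\ell(x,dz)<\infty$ for all $x\in\mathbb R$, $n\ge2$. It acts componentwise on vector-valued functions. In $\xi_i^m$ and $a_n^i$ the upper symbols are indices, not powers. *)

theory Defs
  imports "HOL-Analysis.Analysis" "HOL-Computational_Algebra.Polynomial" "Jordan_Normal_Form.Matrix"
begin

definition transition_kernel :: "(real \<Rightarrow> real measure) \<Rightarrow> bool" where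
  "transition_kernel l \<longleftrightarrow>
     (\<forall>x. sets (l x) = sets borel) \<and>
     (\<forall>B \<in> sets borel. (\<lambda>x. emeasure (l x) B) \<in> borel_measurable borel)"

definition jump_diffusion_op ::
    "(real \<Rightarrow> real) \<Rightarrow> (real \<Rightarrow> real) \<Rightarrow> (real \<Rightarrow> real measure) \<Rightarrow> (real \<Rightarrow> real) \<Rightarrow> real \<Rightarrow> real" where
  "jump_diffusion_op b \<sigma> l f x =
     b x * deriv f x + 1/2 * (\<sigma> x)\<^sup>2 * deriv (deriv f) x
     + (LINT z|l x. f (x + z) - f x - deriv f x * z)"

text \<open>An operator is polynomial if it maps, for every \<open>n\<close>, the polynomials of degree at most
  \<open>n\<close> into themselves.\<close>

definition polynomial_operator :: "((real \<Rightarrow> real) \<Rightarrow> real \<Rightarrow> real) \<Rightarrow> bool" where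
  "polynomial_operator A \<longleftrightarrow>
     (\<forall>n (p :: real poly). degree p \<le> n \<longrightarrow>
        (\<exists>q :: real poly. degree q \<le> n \<and> A (poly p) = poly q))"

definition componentwise ::
    "((real \<Rightarrow> real) \<Rightarrow> real \<Rightarrow> real) \<Rightarrow> (real \<Rightarrow> real Matrix.vec) \<Rightarrow> real \<Rightarrow> real Matrix.vec" where
  "componentwise A F x = Matrix.vec (dim_vec (F x)) (\<lambda>i. A (\<lambda>y. vec_index (F y) i) x)"

definition monomials :: "nat \<Rightarrow> real \<Rightarrow> real Matrix.vec" where
  "monomials n x = Matrix.vec (n + 1) (\<lambda>i. x ^ i)"

definition is_generator_matrix :: "((real \<Rightarrow> real) \<Rightarrow> real \<Rightarrow> real) \<Rightarrow> nat \<Rightarrow> real mat \<Rightarrow> bool" where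
  "is_generator_matrix A n M \<longleftrightarrow>
     M \<in> carrier_mat (n + 1) (n + 1) \<and>
     (\<forall>x. componentwise A (monomials n) x = M *\<^sub>v monomials n x)"

text \<open>The value is meaningful only if the generator matrix exists and is unique.\<close>

definition generator_matrix :: "((real \<Rightarrow> real) \<Rightarrow> real \<Rightarrow> real) \<Rightarrow> nat \<Rightarrow> real mat" where
  "generator_matrix A n = (THE M. is_generator_matrix A n M)"

text \<open>In the following definitions \<open>\<xi> m i\<close> stands for $\xi_i^m$, the coefficient of $x^i$ in the
  \<open>m\<close>-th moment of the jump kernel, and \<open>coeff_a \<dots> n i\<close> stands for $a_n^i$
  (\<open>1 \<le> i \<le> n\<close>).\<close>

definition coeff_a ::
    "real \<Rightarrow> real \<Rightarrow> real \<Rightarrow> (nat \<Rightarrow> nat \<Rightarrow> real) \<Rightarrow> nat \<Rightarrow> nat \<Rightarrow> real" where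
  "coeff_a b0 \<sigma>0 \<sigma>1 \<xi> n i =
     (if i = 1 then
        real n * b0 + 1/2 * real n * (real n - 1) * \<sigma>1 + (\<Sum>k=2..n. real (n choose k) * \<xi> k (k - 1))
      else if i = 2 then
        1/2 * real n * (real n - 1) * \<sigma>0 + (\<Sum>k=2..n. real (n choose k) * \<xi> k (k - 2))
      else (\<Sum>k=i..n. real (n choose k) * \<xi> k (k - i)))"

text \<open>The entries run from $a_n^n$ down to $a_n^1$.\<close>

definition vec_a ::
    "real \<Rightarrow> real \<Rightarrow> real \<Rightarrow> (nat \<Rightarrow> nat \<Rightarrow> real) \<Rightarrow> nat \<Rightarrow> real Matrix.vec" where
  "vec_a b0 \<sigma>0 \<sigma>1 \<xi> n = Matrix.vec n (\<lambda>j. coeff_a b0 \<sigma>0 \<sigma>1 \<xi> n (n - j))"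

definition coeff_c :: "real \<Rightarrow> real \<Rightarrow> (nat \<Rightarrow> nat \<Rightarrow> real) \<Rightarrow> nat \<Rightarrow> real" where
  "coeff_c b1 \<sigma>2 \<xi> n =
     real n * b1 + 1/2 * real n * (real n - 1) * \<sigma>2 + (\<Sum>k=2..n. real (n choose k) * \<xi> k k)"

end

theory Submission
  imports Defs
begin

text \<open>Row \<open>m\<close> of a generator matrix holds the coefficients of the polynomial that the operator assigns to
  \<open>x ^ m\<close>; as this polynomial does not depend on the size of the matrix, the matrices are nested. The
  binomial theorem cancels the first two terms of the jump integrand, leaving a combination of
  moments of order at least 2.\<close>

lemma deriv_poly: "deriv (poly p) = poly (pderiv p)" for p :: "real poly"
  by (intro ext DERIV_imp_deriv poly_DERIV)

text \<open>A vector identity valid for all \<open>x\<close> is, row by row, an identity of real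
  polynomial functions, so comparing coefficients determines every entry. The bound
  \<open>deg\<close> makes each \<open>P i\<close> fit into the available powers
  \<open>0..n\<close>. The equivalence yields existence and uniqueness at once.\<close>

lemma is_generator_matrix_iff_coeff:
  fixes A :: "(real \<Rightarrow> real) \<Rightarrow> real \<Rightarrow> real" and P :: "nat \<Rightarrow> real poly"
  assumes A: "\<And>m x. A (\<lambda>y. y ^ m) x = poly (P m) x"
    and deg: "\<And>m. degree (P m) \<le> m"
  shows "is_generator_matrix A n M \<longleftrightarrow> M = mat (n + 1) (n + 1) (\<lambda>(i, j). coeff (P i) j)"
proof -
  have comp: "componentwise A (monomials n) x = Matrix.vec (n + 1) (\<lambda>i. poly (P i) x)" for x
    by (rule eq_vecI) (auto simp: componentwise_def monomials_def A)
  have mult: "vec_index (N *\<^sub>v monomials n x) i = (\<Sum>j\<le>n. N $$ (i, j) * x ^ j)"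
    if "N \<in> carrier_mat (n + 1) (n + 1)" "i < n + 1" for N x i
    using that by (simp add: scalar_prod_def monomials_def atLeast0AtMost atLeastLessThanSuc_atLeastAtMost
        del: sum.atLeast0_lessThan_Suc sum.op_ivl_Suc)
  \<comment> \<open>The sum up to the degree is padded with zero coefficients up to
    \<open>n\<close>, possible since \<open>degree (P i)\<close> \<le> \<open>i\<close> \<le>
    \<open>n\<close>.\<close>
  have row: "poly (P i) x = (\<Sum>j\<le>n. coeff (P i) j * x ^ j)" if "i < n + 1" for x i
    unfolding poly_altdef using deg[of i] that
    by (intro sum.mono_neutral_left) (auto intro!: coeff_eq_0)
  show ?thesis
  proof
    assume M: "is_generator_matrix A n M"
    then have dim: "M \<in> carrier_mat (n + 1) (n + 1)"
      by (simp add: is_generator_matrix_def)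
    show "M = mat (n + 1) (n + 1) (\<lambda>(i, j). coeff (P i) j)"
    proof (rule eq_matI)
      fix i j assume "i < dim_row (mat (n + 1) (n + 1) (\<lambda>(i, j). coeff (P i) j))"
        and "j < dim_col (mat (n + 1) (n + 1) (\<lambda>(i, j). coeff (P i) j))"
      then have ij: "i < n + 1" "j < n + 1" by auto
      have "poly (P i) x = (\<Sum>j\<le>n. M $$ (i, j) * x ^ j)" for x
      proof -
        have "poly (P i) x = vec_index (componentwise A (monomials n) x) i"
          unfolding comp index_vec[OF ij(1)] ..
        also have "componentwise A (monomials n) x = M *\<^sub>v monomials n x"
          using M unfolding is_generator_matrix_def by blast
        finally show ?thesis
          unfolding mult[OF dim ij(1)] .
      qed
      then have "\<forall>x. (\<Sum>j\<le>n. M $$ (i, j) * x ^ j) = (\<Sum>j\<le>n. coeff (P i) j * x ^ j)"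
        using row[OF ij(1)] by simp
      \<comment> \<open>Polynomial functions that agree at every real point have equal
        coefficients.\<close>
      then have "M $$ (i, j) = coeff (P i) j"
        using ij(2) by (subst (asm) polyfun_eq_coeffs) auto
      then show "M $$ (i, j) = mat (n + 1) (n + 1) (\<lambda>(i, j). coeff (P i) j) $$ (i, j)"
        using ij by simp
    qed (use dim in auto)
  next
    assume M: "M = mat (n + 1) (n + 1) (\<lambda>(i, j). coeff (P i) j)"
    then have dim: "M \<in> carrier_mat (n + 1) (n + 1)" by simp
    have "componentwise A (monomials n) x = M *\<^sub>v monomials n x" for x
    proof (rule eq_vecI)
      fix i assume "i < dim_vec (M *\<^sub>v monomials n x)"
      then have i: "i < n + 1" using dim by simp
      show "vec_index (componentwise A (monomials n) x) i = vec_index (M *\<^sub>v monomials n x) i"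
        unfolding comp mult[OF dim i] index_vec[OF i] row[OF i]
        using i M by (intro sum.cong) auto
    qed (use dim in \<open>simp add: comp\<close>)
    with dim show "is_generator_matrix A n M"
      by (simp add: is_generator_matrix_def)
  qed
qed

lemma generator_matrix_eq_coeff:
  fixes A :: "(real \<Rightarrow> real) \<Rightarrow> real \<Rightarrow> real" and P :: "nat \<Rightarrow> real poly"
  assumes "\<And>m x. A (\<lambda>y. y ^ m) x = poly (P m) x"
    and "\<And>m. degree (P m) \<le> m"
  shows "generator_matrix A n = mat (n + 1) (n + 1) (\<lambda>(i, j). coeff (P i) j)"
  unfolding generator_matrix_def is_generator_matrix_iff_coeff[OF assms] by simp

lemma power_add_second_order_remainder:
  fixes x z :: real
  shows "(x + z) ^ m - x ^ m - real m * x ^ (m - 1) * z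
    = (\<Sum>k=2..m. real (m choose k) * x ^ (m - k) * z ^ k)"
\<comment> \<open>For \<open>m < 2\<close> both sides vanish; otherwise the indices 0 and 1 split
  off from the binomial sum are present and distinct from \<open>{2..m}\<close>.\<close>
proof (cases "m < 2")
  case True
  then have "m = 0 \<or> m = 1" by auto
  then show ?thesis by auto
next
  case False
  have "(x + z) ^ m = (\<Sum>k\<le>m. real (m choose k) * z ^ k * x ^ (m - k))"
    using binomial_ring[of z x m] by (simp add: add.commute)
  also have "{..m} = insert 0 (insert 1 {2..m})"
    using False by auto
  finally show ?thesis
    by (simp add: algebra_simps)
qed

text \<open>For \<open>m < 2\<close> the truncated exponents \<open>m - 1\<close> and \<open>m - 2\<close> are harmless, as the
  factors in front of them vanish.\<close>

definition monomial_image ::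
    "real \<Rightarrow> real \<Rightarrow> real \<Rightarrow> real \<Rightarrow> real \<Rightarrow> (nat \<Rightarrow> nat \<Rightarrow> real) \<Rightarrow> nat \<Rightarrow> real poly" where
  "monomial_image b0 b1 \<sigma>0 \<sigma>1 \<sigma>2 \<xi> m =
     monom (real m * b0) (m - 1) + monom (real m * b1) m
     + Polynomial.smult (1/2 * real m * (real m - 1))
         (monom \<sigma>0 (m - 2) + monom \<sigma>1 (m - 1) + monom \<sigma>2 m)
     + (\<Sum>k=2..m. \<Sum>i=0..k. monom (real (m choose k) * \<xi> k i) (m - k + i))"

lemma degree_monomial_image: "degree (monomial_image b0 b1 \<sigma>0 \<sigma>1 \<sigma>2 \<xi> m) \<le> m"
  unfolding monomial_image_def
  by (intro degree_add_le degree_sum_le order.trans[OF degree_smult_le]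
      order.trans[OF degree_monom_le]) auto

text \<open>The \<open>k\<close>-th moment contributes to the power \<open>m - i\<close> only
  through its coefficient at \<open>k - i\<close>, which requires \<open>i \<le> k\<close>. Drift
  and diffusion lower the exponent by at most 1 and 2 respectively, hence the special cases
  \<open>i = 1\<close> and \<open>i = 2\<close> in \<open>coeff_a\<close>.\<close>

lemma coeff_monomial_image_low:
  assumes "1 \<le> i" "i \<le> m" "2 \<le> m"
  shows "coeff (monomial_image b0 b1 \<sigma>0 \<sigma>1 \<sigma>2 \<xi> m) (m - i) = coeff_a b0 \<sigma>0 \<sigma>1 \<xi> m i"
proof -
  have "(\<Sum>r=0..k. coeff (monom (real (m choose k) * \<xi> k r) (m - k + r)) (m - i))
      = (if i \<le> k then real (m choose k) * \<xi> k (k - i) else 0)" if "k \<in> {2..m}" for k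
  proof -
    \<comment> \<open>The conjunct \<open>i \<le> k\<close> is essential: for \<open>k < i\<close>
      the truncated difference \<open>k - i\<close> is 0 and would wrongly select
      \<open>r = 0\<close>.\<close>
    have eq: "(m - k + r = m - i) = (i \<le> k \<and> r = k - i)" if "r \<in> {0..k}" for r
      using that \<open>k \<in> {2..m}\<close> assms by auto
    have "(\<Sum>r=0..k. coeff (monom (real (m choose k) * \<xi> k r) (m - k + r)) (m - i))
      = (\<Sum>r=0..k. if r = k - i then (if i \<le> k then real (m choose k) * \<xi> k r else 0) else 0)"
      using eq by (intro sum.cong) auto
    then show ?thesis by simp
  qed
  then have "(\<Sum>k=2..m. \<Sum>r=0..k. coeff (monom (real (m choose k) * \<xi> k r) (m - k + r)) (m - i))
      = (\<Sum>k=2..m. if i \<le> k then real (m choose k) * \<xi> k (k - i) else 0)"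
    by (intro sum.cong) auto
  \<comment> \<open>The lower limit \<open>max 2 i\<close> covers both forms in
    \<open>coeff_a\<close>: it is 2 for \<open>i\<close> \<le> 2 and \<open>i\<close> from 3
    on.\<close>
  also have "\<dots> = (\<Sum>k=max 2 i..m. real (m choose k) * \<xi> k (k - i))"
    by (intro sum.mono_neutral_cong_right) auto
  finally have jumps: "(\<Sum>k=2..m. \<Sum>r=0..k.
      coeff (monom (real (m choose k) * \<xi> k r) (m - k + r)) (m - i))
      = (\<Sum>k=max 2 i..m. real (m choose k) * \<xi> k (k - i))" .
  consider "i = 1" | "i = 2" | "i \<ge> 3" using assms by linarith
  then show ?thesis
  proof cases
    case 1
    \<comment> \<open>Since \<open>m\<close> \<ge> 2, truncation does not merge the exponents, so
      only the terms in \<open>b0\<close> and \<sigma>1 survive next to the jumps.\<close>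
    moreover have "m - 2 \<noteq> m - 1" "m \<noteq> m - 1" using assms by auto
    ultimately show ?thesis
      using jumps by (simp add: monomial_image_def coeff_a_def coeff_sum numeral_2_eq_2)
  next
    case 2
    moreover have "m - 1 \<noteq> m - 2" "m \<noteq> m - 2" using assms by auto
    ultimately show ?thesis
      using jumps by (simp add: monomial_image_def coeff_a_def coeff_sum)
  next
    case 3
    moreover have "m - 1 \<noteq> m - i" "m - 2 \<noteq> m - i" "m \<noteq> m - i" using assms 3 by auto
    ultimately show ?thesis
      using jumps by (simp add: monomial_image_def coeff_a_def coeff_sum)
  qed
qed

text \<open>Only the leading terms preserve the degree: \<open>b1\<close> from the drift, \<sigma>2
  from the diffusion, and the coefficient of \<open>x ^ k\<close> in the \<open>k\<close>-th
  moment.\<close>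

lemma coeff_monomial_image_top:
  assumes "2 \<le> m"
  shows "coeff (monomial_image b0 b1 \<sigma>0 \<sigma>1 \<sigma>2 \<xi> m) m = coeff_c b1 \<sigma>2 \<xi> m"
proof -
  have "(\<Sum>r=0..k. coeff (monom (real (m choose k) * \<xi> k r) (m - k + r)) m)
      = real (m choose k) * \<xi> k k" if "k \<in> {2..m}" for k
  proof -
    have "(\<Sum>r=0..k. coeff (monom (real (m choose k) * \<xi> k r) (m - k + r)) m)
      = (\<Sum>r=0..k. if r = k then real (m choose k) * \<xi> k r else 0)"
      using that by (intro sum.cong) auto
    then show ?thesis by simp
  qed
  then have "(\<Sum>k=2..m. \<Sum>r=0..k. coeff (monom (real (m choose k) * \<xi> k r) (m - k + r)) m)
      = (\<Sum>k=2..m. real (m choose k) * \<xi> k k)"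
    by (intro sum.cong) auto
  moreover have "m - 1 \<noteq> m" "m - 2 \<noteq> m" using assms by auto
  ultimately show ?thesis
    by (simp add: monomial_image_def coeff_c_def coeff_sum)
qed

text \<open>The jump integrand is expanded before integrating: after the cancellation only powers
  \<open>z ^ k\<close> with \<open>k\<close> \<ge> 2 remain, whose integrability is assumed, so the
  integral may be taken term by term and the moment polynomials inserted.\<close>

lemma jump_diffusion_op_monomial:
  assumes sets: "sets (l x) = sets borel"
    and finite: "\<And>k. k \<ge> 2 \<Longrightarrow> integrable (l x) (\<lambda>z. \<bar>z\<bar> ^ k)"
    and drift: "b x = b0 + b1 * x"
    and diffusion: "(\<sigma> x)\<^sup>2 = \<sigma>0 + \<sigma>1 * x + \<sigma>2 * x\<^sup>2"
    and moments: "\<And>k. k \<ge> 2 \<Longrightarrow> (LINT z|l x. z ^ k) = (\<Sum>i=0..k. \<xi> k i * x ^ i)"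
  shows "jump_diffusion_op b \<sigma> l (\<lambda>y. y ^ m) x = poly (monomial_image b0 b1 \<sigma>0 \<sigma>1 \<sigma>2 \<xi> m) x"
proof -
  have f: "(\<lambda>y. y ^ m) = poly (monom (1::real) m)"
    by (auto simp: poly_monom)
  have d1: "deriv (\<lambda>y. y ^ m) = (\<lambda>y::real. real m * y ^ (m - 1))"
    unfolding f deriv_poly by (auto simp: pderiv_monom poly_monom)
  have d2: "deriv (deriv (\<lambda>y. y ^ m)) x = real m * (real m - 1) * x ^ (m - 2)"
    unfolding f deriv_poly
    by (cases "m = 0") (auto simp: pderiv_monom poly_monom of_nat_diff numeral_2_eq_2)
  have int: "integrable (l x) (\<lambda>z. z ^ k)" if "k \<ge> 2" for k
  proof (rule integrable_norm_cancel)
    show "integrable (l x) (\<lambda>z. norm (z ^ k))"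
      using finite[OF that] by (simp add: power_abs)
    show "(\<lambda>z. z ^ k) \<in> borel_measurable (l x)"
      unfolding measurable_cong_sets[OF sets refl] by measurable
  qed
  have "(LINT z|l x. (x + z) ^ m - x ^ m - deriv (\<lambda>y. y ^ m) x * z)
      = (LINT z|l x. (\<Sum>k=2..m. real (m choose k) * x ^ (m - k) * z ^ k))"
    unfolding d1 power_add_second_order_remainder ..
  also have "\<dots> = (\<Sum>k=2..m. real (m choose k) * x ^ (m - k) * (LINT z|l x. z ^ k))"
    using int by (subst Bochner_Integration.integral_sum) auto
  also have "\<dots> = (\<Sum>k=2..m. \<Sum>i=0..k. real (m choose k) * \<xi> k i * x ^ (m - k + i))"
    using moments by (intro sum.cong) (auto simp: sum_distrib_left power_add mult_ac simp del: Nat.add_diff_assoc2)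
  finally have jump: "(LINT z|l x. (x + z) ^ m - x ^ m - deriv (\<lambda>y. y ^ m) x * z)
      = (\<Sum>k=2..m. \<Sum>i=0..k. real (m choose k) * \<xi> k i * x ^ (m - k + i))" .
  \<comment> \<open>Absorbing \<open>x\<close> into \<open>x ^ (m - 1)\<close> gives
    \<open>x ^ m\<close> only for \<open>m > 0\<close>; at \<open>m = 0\<close> the factor
    \<open>real m\<close> annihilates both sides.\<close>
  have drift': "b x * (real m * x ^ (m - 1)) = real m * b0 * x ^ (m - 1) + real m * b1 * x ^ m"
    by (cases m) (auto simp: drift algebra_simps)
  have diffusion': "1/2 * (\<sigma> x)\<^sup>2 * (real m * (real m - 1) * x ^ (m - 2))
      = 1/2 * real m * (real m - 1) * (\<sigma>0 * x ^ (m - 2) + \<sigma>1 * x ^ (m - 1) + \<sigma>2 * x ^ m)"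
  proof (cases "m < 2")
    case True
    then have "m = 0 \<or> m = 1" by auto
    then show ?thesis by auto
  next
    case False
    then obtain r where "m = r + 2" by (metis add.commute le_iff_add not_less)
    then have "(\<sigma> x)\<^sup>2 * x ^ (m - 2) = \<sigma>0 * x ^ (m - 2) + \<sigma>1 * x ^ (m - 1) + \<sigma>2 * x ^ m"
      unfolding diffusion by (simp add: algebra_simps power2_eq_square)
    then show ?thesis by (simp only: mult_ac)
  qed
  show ?thesis
    unfolding jump_diffusion_op_def jump d2 unfolding d1 drift' diffusion'
    by (simp add: monomial_image_def poly_sum poly_monom)
qed

theorem theorem5p1:
  fixes b \<sigma> :: "real \<Rightarrow> real"
    and l :: "real \<Rightarrow> real measure"
    and b0 b1 \<sigma>0 \<sigma>1 \<sigma>2 :: real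
    and \<xi> :: "nat \<Rightarrow> nat \<Rightarrow> real"
    and n :: nat
  assumes b_meas: "b \<in> borel_measurable borel"
    and sigma_meas: "\<sigma> \<in> borel_measurable borel"
    and kernel: "transition_kernel l"
    and no_atom: "\<And>x. emeasure (l x) {0} = 0"
    and small_jumps: "\<And>x. integrable (l x) (\<lambda>z. min \<bar>z\<bar> (\<bar>z\<bar>\<^sup>2))"
    and moments_finite: "\<And>x m. m \<ge> 2 \<Longrightarrow> integrable (l x) (\<lambda>z. \<bar>z\<bar> ^ m)"
    and polynomial: "polynomial_operator (jump_diffusion_op b \<sigma> l)"
    and drift: "\<And>x. b x = b0 + b1 * x"
    and diffusion: "\<And>x. (\<sigma> x)\<^sup>2 = \<sigma>0 + \<sigma>1 * x + \<sigma>2 * x\<^sup>2"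
    and moments: "\<And>m x. m \<ge> 2 \<Longrightarrow> (LINT z|l x. z ^ m) = (\<Sum>i=0..m. \<xi> m i * x ^ i)"
    and n: "n \<ge> 2"
  shows "(\<exists>!M. is_generator_matrix (jump_diffusion_op b \<sigma> l) n M) \<and>
     generator_matrix (jump_diffusion_op b \<sigma> l) n =
       four_block_mat
         (generator_matrix (jump_diffusion_op b \<sigma> l) (n - 1)) (0\<^sub>m n 1)
         (mat_of_row (vec_a b0 \<sigma>0 \<sigma>1 \<xi> n)) (mat_of_rows_list 1 [[coeff_c b1 \<sigma>2 \<xi> n]]) \<and>
     generator_matrix (jump_diffusion_op b \<sigma> l) 1 = mat_of_rows_list 2 [[0, 0], [b0, b1]]"
proof -
  define P where "P = monomial_image b0 b1 \<sigma>0 \<sigma>1 \<sigma>2 \<xi>"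
  let ?A = "jump_diffusion_op b \<sigma> l"
  have A: "?A (\<lambda>y. y ^ m) x = poly (P m) x" for m x
    unfolding P_def using kernel moments_finite drift diffusion moments
    by (intro jump_diffusion_op_monomial) (auto simp: transition_kernel_def)
  have deg: "degree (P m) \<le> m" for m
    unfolding P_def by (rule degree_monomial_image)
  \<comment> \<open>The matrix size stays free here: the same family \<open>P\<close> describes the
    generator matrices of orders \<open>n\<close>, \<open>n - 1\<close> and 1.\<close>
  note G = generator_matrix_eq_coeff[of ?A P, OF A deg]
  have "\<exists>!M. is_generator_matrix ?A n M"
    unfolding is_generator_matrix_iff_coeff[of ?A P, OF A deg] by simp
  moreover have "generator_matrix ?A n =
       four_block_mat (generator_matrix ?A (n - 1)) (0\<^sub>m n 1)
         (mat_of_row (vec_a b0 \<sigma>0 \<sigma>1 \<xi> n)) (mat_of_rows_list 1 [[coeff_c b1 \<sigma>2 \<xi> n]])"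
    (is "_ = ?B")
  proof (rule eq_matI)
    show dims: "dim_row (generator_matrix ?A n) = dim_row ?B"
      "dim_col (generator_matrix ?A n) = dim_col ?B"
      using n by (auto simp: G mat_of_rows_list_def vec_a_def)
    fix i j assume "i < dim_row ?B" "j < dim_col ?B"
    then have ij: "i < n + 1" "j < n + 1"
      unfolding dims[symmetric] by (auto simp: G)
    \<comment> \<open>The four cases are the four blocks. For \<open>i < n\<close> the last column
      vanishes because \<open>degree (P i)\<close> \<le> \<open>i\<close> < \<open>n\<close>; in the
      last row, column \<open>j\<close> belongs to the power \<open>j = n - (n - j)\<close>, which
      explains the descending index \<open>n - j\<close> in \<open>vec_a\<close>.\<close>
    then have "coeff (P i) j =
        (if i < n then if j < n then coeff (P i) j else 0
         else if j < n then coeff_a b0 \<sigma>0 \<sigma>1 \<xi> n (n - j) else coeff_c b1 \<sigma>2 \<xi> n)"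
      using n deg[of i] coeff_monomial_image_low[of "n - j" n b0 b1 \<sigma>0 \<sigma>1 \<sigma>2 \<xi>]
        coeff_monomial_image_top[of n b0 b1 \<sigma>0 \<sigma>1 \<sigma>2 \<xi>]
      by (auto simp: P_def less_Suc_eq intro!: coeff_eq_0)
    also have "\<dots> = ?B $$ (i, j)"
      using ij n by (auto simp: G mat_of_rows_list_def mat_of_row_def vec_a_def)
    finally show "generator_matrix ?A n $$ (i, j) = ?B $$ (i, j)"
      using ij by (simp add: G)
  qed
  \<comment> \<open>For \<open>m < 2\<close> the diffusion factor is zero and the jump sum is empty,
    so \<open>P 0 = 0\<close> and \<open>P 1\<close> is the drift polynomial.\<close>
  moreover have "generator_matrix ?A 1 = mat_of_rows_list 2 [[0, 0], [b0, b1]]"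
    by (rule eq_matI)
      (auto simp: G mat_of_rows_list_def P_def monomial_image_def less_Suc_eq numeral_2_eq_2)
  ultimately show ?thesis by blast
qed

end
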